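(* Let $R$ be a commutative ring with $1\neq0$, let $I$ be an ideal of $R$, and let $S$ be a strongly multiplicative set of $R$ such that $I\cap S=\varnothing$. Then $\overline S=\{s+I: s\in S\}$ is a strongly multiplicative set of $R/I$.
   Context: A multiplicative set $S$ of a commutative ring $R$ is a subset with $0\notin S$, $1\in S$, and $st\in S$ for all $s,t\in S$. It is strongly multiplicative if $\bigl(\bigcap_{i\in\Delta}s_iR\bigr)\cap S\neq\varnothing$ for every family $(s_i)_{i\in\Delta}$ of elements of $S$. *)

theory Defs
  imports "HOL-Algebra.Algebra"
begin

definition multiplicative_set :: "('a, 'm) ring_scheme \<Rightarrow> 'a set \<Rightarrow> bool" where
  "multiplicative_set R S \<longleftrightarrow>
     S \<subseteq> carrier R \<and> \<zero>\<^bsub>R\<^esub> \<notin> S \<and> \<one>\<^bsub>R\<^esub> \<in> S \<and> (\<forall>s\<in>S. \<forall>t\<in>S. s \<otimes>\<^bsub>R\<^esub> t \<in> S)"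

text \<open>
  The intersection of the ideals \<open>s\<^sub>i R\<close> depends only on the set of members of the family, so
  families of elements of \<open>S\<close> are represented by subsets of \<open>S\<close>, of any cardinality; the lemma
  below recovers families over an arbitrary index type. Intersecting with the carrier
  makes the empty intersection equal to \<open>R\<close>.
\<close>

definition strongly_multiplicative_set :: "('a, 'm) ring_scheme \<Rightarrow> 'a set \<Rightarrow> bool" where
  "strongly_multiplicative_set R S \<longleftrightarrow>
     multiplicative_set R S \<and>
     (\<forall>T. T \<subseteq> S \<longrightarrow> (carrier R \<inter> (\<Inter>s\<in>T. PIdl\<^bsub>R\<^esub> s)) \<inter> S \<noteq> {})"

lemma strongly_multiplicative_set_family:
  fixes s :: "'i \<Rightarrow> 'a" and \<Delta> :: "'i set"
  assumes "strongly_multiplicative_set R S" and "\<And>i. i \<in> \<Delta> \<Longrightarrow> s i \<in> S"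
  shows "(carrier R \<inter> (\<Inter>i\<in>\<Delta>. PIdl\<^bsub>R\<^esub> (s i))) \<inter> S \<noteq> {}"
proof -
  have "s ` \<Delta> \<subseteq> S" using assms(2) by blast
  then have "(carrier R \<inter> (\<Inter>t\<in>s ` \<Delta>. PIdl\<^bsub>R\<^esub> t)) \<inter> S \<noteq> {}"
    using assms(1) unfolding strongly_multiplicative_set_def by blast
  then show ?thesis by (simp add: image_image)
qed

end

theory Submission
  imports Defs
begin

text \<open>The projection from \<open>R\<close> to \<open>R Quot I\<close> is a surjective ring
  homomorphism, so it preserves multiples: if \<open>x\<close> lies in the principal ideal of
  \<open>s\<close>, its coset lies in that of \<open>I +> s\<close>
  (\<open>rcoset_in_cgenideal_Quot\<close>). Given a set of cosets of elements of \<open>S\<close>,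
  lift it to \<open>S\<close>, take a common multiple in \<open>S\<close> of the lifted elements,
  and project it back. That the cosets form a multiplicative set at all is
  \<open>multiplicative_set_Quot\<close>; disjointness of \<open>I\<close> and \<open>S\<close>
  keeps zero out.\<close>

lemma (in ideal) Quot_mult_rcoset:
  assumes "x \<in> carrier R" "y \<in> carrier R"
  shows "(I +> x) \<otimes>\<^bsub>R Quot I\<^esub> (I +> y) = I +> (x \<otimes> y)"
  using assms rcoset_mult_add by (simp add: FactRing_def)

text \<open>A factorization \<open>x = r \<otimes> s\<close> projects to one of
  \<open>I +> x\<close>, with cofactor \<open>I +> r\<close>.\<close>

lemma (in ideal) rcoset_in_cgenideal_Quot:
  assumes "s \<in> carrier R" "x \<in> PIdl s"
  shows "I +> x \<in> PIdl\<^bsub>R Quot I\<^esub> (I +> s)"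
proof -
  obtain r where r: "r \<in> carrier R" "x = r \<otimes> s"
    using assms(2) unfolding cgenideal_def by blast
  have "I +> r \<in> carrier (R Quot I)"
    using r(1) by (auto simp: FactRing_def A_RCOSETS_def')
  then show ?thesis
    using Quot_mult_rcoset[OF r(1) assms(1)] r(2) unfolding cgenideal_def by force
qed

lemma (in ideal) multiplicative_set_Quot:
  assumes "multiplicative_set R S" "I \<inter> S = {}"
  shows "multiplicative_set (R Quot I) {I +> s | s. s \<in> S}"
proof -
  have S: "S \<subseteq> carrier R" "\<one> \<in> S" "\<And>s t. s \<in> S \<Longrightarrow> t \<in> S \<Longrightarrow> s \<otimes> t \<in> S"
    using assms(1) unfolding multiplicative_set_def by auto
  \<comment> \<open>The zero of the quotient is \<open>I\<close> itself. Since \<open>s\<close> lies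
    in its own coset, equality would put \<open>s\<close> into both \<open>I\<close> and
    \<open>S\<close>.\<close>
  have "I \<noteq> I +> s" if "s \<in> S" for s
    using that S(1) assms(2) a_rcos_self[of s] by blast
  then have zero: "\<zero>\<^bsub>R Quot I\<^esub> \<notin> {I +> s | s. s \<in> S}"
    by (auto simp: FactRing_def)
  have one: "\<one>\<^bsub>R Quot I\<^esub> \<in> {I +> s | s. s \<in> S}"
    using S(2) by (auto simp: FactRing_def)
  have carr: "{I +> s | s. s \<in> S} \<subseteq> carrier (R Quot I)"
    using S(1) by (auto simp: FactRing_def A_RCOSETS_def')
  have "(I +> s) \<otimes>\<^bsub>R Quot I\<^esub> (I +> t) \<in> {I +> s | s. s \<in> S}"
    if "s \<in> S" "t \<in> S" for s t
  proof -
    have "(I +> s) \<otimes>\<^bsub>R Quot I\<^esub> (I +> t) = I +> (s \<otimes> t)"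
      using that S(1) by (intro Quot_mult_rcoset) auto
    then show ?thesis
      using S(3)[OF that] by blast
  qed
  then show ?thesis
    unfolding multiplicative_set_def using carr zero one by blast
qed

theorem corollary2p12:
  fixes R :: "('a, 'm) ring_scheme" and I S :: "'a set"
  assumes "cring R"
    and "\<one>\<^bsub>R\<^esub> \<noteq> \<zero>\<^bsub>R\<^esub>"
    and "ideal I R"
    and "strongly_multiplicative_set R S"
    and "I \<inter> S = {}"
  shows "strongly_multiplicative_set (R Quot I) {I +>\<^bsub>R\<^esub> s | s. s \<in> S}"
proof -
  interpret ideal I R by fact
  have S: "multiplicative_set R S" "S \<subseteq> carrier R"
    using assms(4) unfolding strongly_multiplicative_set_def multiplicative_set_def by auto
  have mult: "multiplicative_set (R Quot I) {I +>\<^bsub>R\<^esub> s | s. s \<in> S}"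
    using S(1) assms(5) by (rule multiplicative_set_Quot)
  have "(carrier (R Quot I) \<inter> (\<Inter>t\<in>T. PIdl\<^bsub>R Quot I\<^esub> t)) \<inter> {I +>\<^bsub>R\<^esub> s | s. s \<in> S} \<noteq> {}"
    if T: "T \<subseteq> {I +>\<^bsub>R\<^esub> s | s. s \<in> S}" for T
  proof -
    \<comment> \<open>Lifting to all representatives in \<open>S\<close> avoids choosing one for
      each coset; the larger family is harmless, as the hypothesis on \<open>S\<close> covers
      subsets of any size.\<close>
    define T' where "T' = {s \<in> S. I +>\<^bsub>R\<^esub> s \<in> T}"
    have "T' \<subseteq> S"
      by (auto simp: T'_def)
    then have "(carrier R \<inter> (\<Inter>s\<in>T'. PIdl\<^bsub>R\<^esub> s)) \<inter> S \<noteq> {}"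
      using assms(4) unfolding strongly_multiplicative_set_def by blast
    then obtain x where x: "x \<in> S" "\<And>s. s \<in> T' \<Longrightarrow> x \<in> PIdl\<^bsub>R\<^esub> s"
      by blast
    have "I +>\<^bsub>R\<^esub> x \<in> PIdl\<^bsub>R Quot I\<^esub> t" if t: "t \<in> T" for t
    proof -
      obtain s where s: "s \<in> S" "t = I +>\<^bsub>R\<^esub> s"
        using T t by blast
      then have "s \<in> T'"
        using s t by (simp add: T'_def)
      then show ?thesis
        using s S(2) x(2) rcoset_in_cgenideal_Quot by blast
    qed
    \<comment> \<open>For empty \<open>T\<close> this does not follow from membership in the
      principal ideals.\<close>
    moreover have "I +>\<^bsub>R\<^esub> x \<in> carrier (R Quot I)"
      using mult x(1) unfolding multiplicative_set_def by blast
    ultimately show ?thesis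
      using x(1) by blast
  qed
  then show ?thesis
    unfolding strongly_multiplicative_set_def using mult by blast
qed

end
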